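(* Let $\Gamma\subset\{H_n\mid n\in\mathbb{N}\}$ be finite, where $H_n$ denotes the equation $$(1+\underline{n}+x^2)\cdot(1+\underline{n}+x^2)^{-1}=1 .$$ Then $\mathbb{Q}_0\not\cong\mathcal{I}(\Sigma_{\mathsf{Md}},\mathsf{Md}+\Gamma)$.
   Context: The signature $\Sigma_{\mathsf{Md}}$ of meadows has constants $0,1$, binary operations $+,\cdot$, and unary operations $-$ and ${}^{-1}$. The set $\mathsf{Md}$ of meadow axioms consists of the following equations (variables implicitly universally quantified): $(x+y)+z=x+(y+z)$; $x+y=y+x$; $x+0=x$; $x+(-x)=0$; $(x\cdot y)\cdot z=x\cdot(y\cdot z)$; $x\cdot y=y\cdot x$; $1\cdot x=x$; $x\cdot(y+z)=x\cdot y+x\cdot z$; $(x^{-1})^{-1}=x$; $x\cdot(x\cdot x^{-1})=x$. For $n\in\mathbb{N}=\{0,1,2,\dots\}$ the numeral $\underline{n}$ is the closed term defined by $\underline{0}:=0$, $\underline{n+1}:=\underline{n}+1$; and $x^2$ abbreviates $x\cdot x$. In $H_n$ the variable $x$ is implicitly universally quantified. For a set $\Gamma$ of equations over $\Sigma_{\mathsf{Md}}$, $\mathcal{I}(\Sigma_{\mathsf{Md}},\mathsf{Md}+\Gamma)$ denotes the initial algebra of the equational theory $\mathsf{Md}\cup\Gamma$, i.e. the algebra of closed $\Sigma_{\mathsf{Md}}$-terms modulo equality provable from $\mathsf{Md}\cup\Gamma$; $\cong$ is isomorphism of $\Sigma_{\mathsf{Md}}$-algebras. $\mathbb{Q}_0$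 is the $\Sigma_{\mathsf{Md}}$-algebra obtained from the field of rational numbers by making the multiplicative inverse total via $0^{-1}=0$. *)

theory Defs
  imports Complex_Main
begin

datatype mterm =
    MVar nat
  | MZero
  | MOne
  | MAdd mterm mterm
  | MMul mterm mterm
  | MNeg mterm
  | MInv mterm

primrec mvars :: "mterm \<Rightarrow> nat set" where
  "mvars (MVar x) = {x}"
| "mvars MZero = {}"
| "mvars MOne = {}"
| "mvars (MAdd s t) = mvars s \<union> mvars t"
| "mvars (MMul s t) = mvars s \<union> mvars t"
| "mvars (MNeg t) = mvars t"
| "mvars (MInv t) = mvars t"

definition closed_terms :: "mterm set" where
  "closed_terms = {t. mvars t = {}}"

primrec msubst :: "(nat \<Rightarrow> mterm) \<Rightarrow> mterm \<Rightarrow> mterm" where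
  "msubst \<sigma> (MVar x) = \<sigma> x"
| "msubst \<sigma> MZero = MZero"
| "msubst \<sigma> MOne = MOne"
| "msubst \<sigma> (MAdd s t) = MAdd (msubst \<sigma> s) (msubst \<sigma> t)"
| "msubst \<sigma> (MMul s t) = MMul (msubst \<sigma> s) (msubst \<sigma> t)"
| "msubst \<sigma> (MNeg t) = MNeg (msubst \<sigma> t)"
| "msubst \<sigma> (MInv t) = MInv (msubst \<sigma> t)"

text \<open>An equation is a pair of terms, its variables being implicitly universally quantified.\<close>

type_synonym mequation = "mterm \<times> mterm"

inductive derivable :: "mequation set \<Rightarrow> mterm \<Rightarrow> mterm \<Rightarrow> bool" for E :: "mequation set" where
  ax: "(s, t) \<in> E \<Longrightarrow> derivable E (msubst \<sigma> s) (msubst \<sigma> t)"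
| refl: "derivable E t t"
| sym: "derivable E s t \<Longrightarrow> derivable E t s"
| trans: "derivable E s t \<Longrightarrow> derivable E t u \<Longrightarrow> derivable E s u"
| add: "derivable E s s' \<Longrightarrow> derivable E t t' \<Longrightarrow> derivable E (MAdd s t) (MAdd s' t')"
| mul: "derivable E s s' \<Longrightarrow> derivable E t t' \<Longrightarrow> derivable E (MMul s t) (MMul s' t')"
| neg: "derivable E t t' \<Longrightarrow> derivable E (MNeg t) (MNeg t')"
| inv: "derivable E t t' \<Longrightarrow> derivable E (MInv t) (MInv t')"

definition Md :: "mequation set" where
  "Md = (let x = MVar 0; y = MVar 1; z = MVar 2 in
    {(MAdd (MAdd x y) z, MAdd x (MAdd y z)),
     (MAdd x y, MAdd y x),
     (MAdd x MZero, x),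
     (MAdd x (MNeg x), MZero),
     (MMul (MMul x y) z, MMul x (MMul y z)),
     (MMul x y, MMul y x),
     (MMul MOne x, x),
     (MMul x (MAdd y z), MAdd (MMul x y) (MMul x z)),
     (MInv (MInv x), x),
     (MMul x (MMul x (MInv x)), x)})"

primrec mnumeral :: "nat \<Rightarrow> mterm" where
  "mnumeral 0 = MZero"
| "mnumeral (Suc n) = MAdd (mnumeral n) MOne"

definition H :: "nat \<Rightarrow> mequation" where
  "H n = (let x = MVar 0; p = MAdd (MAdd MOne (mnumeral n)) (MMul x x)
          in (MMul p (MInv p), MOne))"

record 'a malgebra =
  mcarrier :: "'a set"
  mzero :: 'a
  mone :: 'a
  madd :: "'a \<Rightarrow> 'a \<Rightarrow> 'a"
  mmul :: "'a \<Rightarrow> 'a \<Rightarrow> 'a"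
  mneg :: "'a \<Rightarrow> 'a"
  minv :: "'a \<Rightarrow> 'a"

definition malgebra_iso :: "'a malgebra \<Rightarrow> 'b malgebra \<Rightarrow> ('a \<Rightarrow> 'b) \<Rightarrow> bool" where
  "malgebra_iso A B h \<longleftrightarrow>
     bij_betw h (mcarrier A) (mcarrier B) \<and>
     h (mzero A) = mzero B \<and>
     h (mone A) = mone B \<and>
     (\<forall>x\<in>mcarrier A. \<forall>y\<in>mcarrier A. h (madd A x y) = madd B (h x) (h y)) \<and>
     (\<forall>x\<in>mcarrier A. \<forall>y\<in>mcarrier A. h (mmul A x y) = mmul B (h x) (h y)) \<and>
     (\<forall>x\<in>mcarrier A. h (mneg A x) = mneg B (h x)) \<and>
     (\<forall>x\<in>mcarrier A. h (minv A x) = minv B (h x))"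

definition malgebra_isomorphic :: "'a malgebra \<Rightarrow> 'b malgebra \<Rightarrow> bool" (infix "\<cong>\<^sub>M" 50) where
  "A \<cong>\<^sub>M B \<longleftrightarrow> (\<exists>h. malgebra_iso A B h)"

text \<open>The library inverse on \<^typ>\<open>rat\<close> is total with inverse of zero equal to zero.\<close>

definition Q0 :: "rat malgebra" where
  "Q0 = \<lparr>mcarrier = UNIV, mzero = 0, mone = 1, madd = (+), mmul = (*),
         mneg = uminus, minv = inverse\<rparr>"

definition closed_eq :: "mequation set \<Rightarrow> (mterm \<times> mterm) set" where
  "closed_eq E = {(s, t). s \<in> closed_terms \<and> t \<in> closed_terms \<and> derivable E s t}"

abbreviation closed_class :: "mequation set \<Rightarrow> mterm \<Rightarrow> mterm set" where
  "closed_class E t \<equiv> closed_eq E `` {t}"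

text \<open>The unions below range over representatives; all of them yield the same class.\<close>

definition initial_algebra :: "mequation set \<Rightarrow> mterm set malgebra" where
  "initial_algebra E =
     \<lparr>mcarrier = closed_terms // closed_eq E,
      mzero = closed_class E MZero,
      mone = closed_class E MOne,
      madd = (\<lambda>A B. \<Union>s\<in>A. \<Union>t\<in>B. closed_class E (MAdd s t)),
      mmul = (\<lambda>A B. \<Union>s\<in>A. \<Union>t\<in>B. closed_class E (MMul s t)),
      mneg = (\<lambda>A. \<Union>t\<in>A. closed_class E (MNeg t)),
      minv = (\<lambda>A. \<Union>t\<in>A. closed_class E (MInv t))\<rparr>"

lemma closed_terms_simps [simp]:
  "MVar x \<notin> closed_terms"
  "MZero \<in> closed_terms"
  "MOne \<in> closed_terms"
  "MAdd s t \<in> closed_terms \<longleftrightarrow> s \<in> closed_terms \<and> t \<in> closed_terms"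
  "MMul s t \<in> closed_terms \<longleftrightarrow> s \<in> closed_terms \<and> t \<in> closed_terms"
  "MNeg t \<in> closed_terms \<longleftrightarrow> t \<in> closed_terms"
  "MInv t \<in> closed_terms \<longleftrightarrow> t \<in> closed_terms"
  by (auto simp: closed_terms_def)

lemma equiv_closed_eq: "equiv closed_terms (closed_eq E)"
  by (rule equivI)
     (auto simp: closed_eq_def refl_on_def sym_def trans_def
           intro: derivable.refl derivable.sym derivable.trans)

lemma initial_algebra_ops:
  assumes s: "s \<in> closed_terms" and t: "t \<in> closed_terms"
  shows "madd (initial_algebra E) (closed_class E s) (closed_class E t) = closed_class E (MAdd s t)"
    and "mmul (initial_algebra E) (closed_class E s) (closed_class E t) = closed_class E (MMul s t)"
    and "mneg (initial_algebra E) (closed_class E t) = closed_class E (MNeg t)"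
    and "minv (initial_algebra E) (closed_class E t) = closed_class E (MInv t)"
proof -
  have "(\<lambda>s t. closed_class E (MAdd s t)) respects2 closed_eq E"
    by (rule congruent2I', rule equiv_class_eq[OF equiv_closed_eq])
       (auto simp: closed_eq_def intro: derivable.add)
  from UN_equiv_class2[OF equiv_closed_eq equiv_closed_eq this s t]
  show "madd (initial_algebra E) (closed_class E s) (closed_class E t) = closed_class E (MAdd s t)"
    by (simp add: initial_algebra_def)
  have "(\<lambda>s t. closed_class E (MMul s t)) respects2 closed_eq E"
    by (rule congruent2I', rule equiv_class_eq[OF equiv_closed_eq])
       (auto simp: closed_eq_def intro: derivable.mul)
  from UN_equiv_class2[OF equiv_closed_eq equiv_closed_eq this s t]
  show "mmul (initial_algebra E) (closed_class E s) (closed_class E t) = closed_class E (MMul s t)"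
    by (simp add: initial_algebra_def)
  have "(\<lambda>t. closed_class E (MNeg t)) respects closed_eq E"
    by (rule congruentI, rule equiv_class_eq[OF equiv_closed_eq])
       (auto simp: closed_eq_def intro: derivable.neg)
  from UN_equiv_class[OF equiv_closed_eq this t]
  show "mneg (initial_algebra E) (closed_class E t) = closed_class E (MNeg t)"
    by (simp add: initial_algebra_def)
  have "(\<lambda>t. closed_class E (MInv t)) respects closed_eq E"
    by (rule congruentI, rule equiv_class_eq[OF equiv_closed_eq])
       (auto simp: closed_eq_def intro: derivable.inv)
  from UN_equiv_class[OF equiv_closed_eq this t]
  show "minv (initial_algebra E) (closed_class E t) = closed_class E (MInv t)"
    by (simp add: initial_algebra_def)
qed

end

theory Submission
  imports Defs "HOL-Number_Theory.Number_Theory"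
begin

text \<open>
  In \<^const>\<open>Q0\<close> every positive numeral is invertible, so an isomorphism would make
  \<open>p \<cdot> p\<inverse> = 1\<close> derivable for every positive integer \<open>p\<close>. This is refuted by one
  meadow of prime characteristic: if \<open>\<Gamma>\<close> consists of equations \<open>H n\<close> with \<open>n < N\<close>, and \<open>p\<close> is a
  prime for which none of \<open>-1, \<dots>, -N\<close> is a square modulo \<open>p\<close>, then \<open>1 + n + x\<^sup>2\<close> never
  vanishes in the field with \<open>p\<close> elements, which is therefore a model of \<open>Md \<union> \<Gamma>\<close> in
  which \<open>p \<cdot> p\<inverse> = 0\<close>.

  What remains is number theory: the existence of such a prime
  (\<open>prime_negatives_nonresidues\<close>). Any prime \<open>p \<equiv> -1\<close> modulo \<open>8 N!\<close> would do, but the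
  following argument avoids both Dirichlet's theorem on primes in progressions and quadratic
  reciprocity. Let \<open>L = 4 N!\<close>. It suffices to find an integer
  \<open>M < 0\<close> with \<open>M \<equiv> 1\<close> modulo \<open>L\<close> which, for each \<open>i\<close> with \<open>1 \<le> i \<le> N\<close>, has the form
  \<open>x\<^sup>2 - i y\<^sup>2\<close>. Indeed \<open>-M \<equiv> 3\<close> modulo 4, so some prime \<open>p \<equiv> 3\<close> modulo 4 divides
  \<open>M\<close> to an odd power; a prime modulo which \<open>i\<close> is not a square divides \<open>x\<^sup>2 - i y\<^sup>2\<close> only to
  even powers, so all of \<open>1, \<dots>, N\<close> are squares modulo \<open>p\<close>. They are coprime to \<open>p\<close>, because
  \<open>M\<close> is coprime to \<open>L\<close>, and \<open>-1\<close> is not a square modulo \<open>p\<close>; hence none of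
  \<open>-1, \<dots>, -N\<close> is a square.

  Such an \<open>M\<close> is the product of the \<open>2\<^sup>N\<close> numbers
  \<open>t \<plusminus> L\<surd>1 \<plusminus> L\<surd>2 \<plusminus> \<dots> \<plusminus> L\<surd>N\<close> for an integer \<open>t \<equiv> 1\<close> modulo \<open>L\<close>. Grouping
  the factors by the sign of \<open>L\<surd>i\<close> exhibits the product as a norm from \<open>\<int>[\<surd>i]\<close>, that is, as
  \<open>x\<^sup>2 - i y\<^sup>2\<close>. The smallest of the \<open>2\<^sup>N\<close> factors lies at least \<open>2L\<close> below all others, which
  leaves room to choose \<open>t\<close> such that it is the only negative one.
\<close>

section \<open>Products over all choices of signs\<close>

text \<open>The product of \<open>t \<plusminus> r\<^sub>1 \<plusminus> \<dots> \<plusminus> r\<^sub>n\<close> over all \<open>2\<^sup>n\<close> choices of signs. Choices that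
  happen to give equal sums are counted separately, so square roots may be listed without any
  regard to their linear dependence over the rationals.\<close>
primrec sign_prod :: "real list \<Rightarrow> real \<Rightarrow> real" where
  "sign_prod [] t = t"
| "sign_prod (r # rs) t = sign_prod rs (t + r) * sign_prod rs (t - r)"

text \<open>The product does not depend on the order of the list, so that the recursion can be
  unfolded at any chosen entry.\<close>
lemma sign_prod_remove1:
  "r \<in> set rs \<Longrightarrow> sign_prod rs t = sign_prod (r # remove1 r rs) t"
  by (induction rs arbitrary: t) (auto simp: algebra_simps)

lemma sign_prod_pos:
  assumes "\<forall>r\<in>set rs. r \<ge> 0" "t > sum_list rs"
  shows "sign_prod rs t > 0"
  using assms by (induction rs arbitrary: t) (auto intro!: mult_pos_pos)

text \<open>The factor with all signs negative is below zero, and changing a sign adds at least \<open>2d\<close>,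
  which makes every other factor positive.\<close>
lemma sign_prod_neg:
  assumes "\<forall>r\<in>set rs. r \<ge> d" "d \<ge> 0" "sum_list rs - 2 * d < t" "t < sum_list rs"
  shows "sign_prod rs t < 0"
  using assms
proof (induction rs arbitrary: t)
  case (Cons r rs)
  have "sign_prod rs (t + r) > 0"
    using Cons.prems by (intro sign_prod_pos) auto
  moreover have "sign_prod rs (t - r) < 0"
    using Cons.prems by (intro Cons.IH) auto
  ultimately show ?case by (simp add: mult_pos_neg)
qed auto

inductive int_poly_fun :: "(real \<Rightarrow> real) \<Rightarrow> bool" where
  const: "int_poly_fun (\<lambda>t. of_int c)"
| ident: "int_poly_fun (\<lambda>t. t)"
| add: "int_poly_fun f \<Longrightarrow> int_poly_fun g \<Longrightarrow> int_poly_fun (\<lambda>t. f t + g t)"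
| mult: "int_poly_fun f \<Longrightarrow> int_poly_fun g \<Longrightarrow> int_poly_fun (\<lambda>t. f t * g t)"

lemma int_poly_fun_Ints: "int_poly_fun f \<Longrightarrow> t \<in> \<int> \<Longrightarrow> f t \<in> \<int>"
  by (induction rule: int_poly_fun.induct) auto

text \<open>This is the expansion of \<open>f (t + s)\<close> in powers of \<open>s\<close>, with \<open>s\<^sup>2 = j\<close> substituted: the odd
  powers contribute \<open>s Y\<close>, and the even powers contribute \<open>f\<close> itself and multiples of \<open>j\<close>. Keeping the
  factor \<open>j\<close> of the latter visible is what later controls residues modulo a divisor of \<open>j\<close>.
  Since \<open>Y\<close> and \<open>Z\<close> do not depend on \<open>s\<close>, the formula applies to both square roots of \<open>j\<close>.\<close>
lemma int_poly_fun_shift: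
  assumes "int_poly_fun f"
  shows "\<exists>Y Z. int_poly_fun Y \<and> int_poly_fun Z \<and>
    (\<forall>s t. s\<^sup>2 = of_int j \<longrightarrow> f (t + s) = f t + of_int j * Z t + s * Y t)"
  using assms
proof (induction rule: int_poly_fun.induct)
  case (const c)
  show ?case
    using int_poly_fun.const[of 0] by (intro exI[of _ "\<lambda>t. 0"]) simp
next
  case ident
  show ?case
    using int_poly_fun.const[of 0] int_poly_fun.const[of 1]
    by (intro exI[of _ "\<lambda>t. 1"] exI[of _ "\<lambda>t. 0"]) simp
next
  case (add f g)
  then obtain Y Z Y' Z' where *: "int_poly_fun Y" "int_poly_fun Z" "int_poly_fun Y'" "int_poly_fun Z'"
    "\<And>s t. s\<^sup>2 = of_int j \<Longrightarrow> f (t + s) = f t + of_int j * Z t + s * Y t"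
    "\<And>s t. s\<^sup>2 = of_int j \<Longrightarrow> g (t + s) = g t + of_int j * Z' t + s * Y' t"
    by blast
  show ?case
  proof (intro exI conjI allI impI)
    show "int_poly_fun (\<lambda>t. Y t + Y' t)" "int_poly_fun (\<lambda>t. Z t + Z' t)"
      by (intro int_poly_fun.add *)+
    fix s t :: real assume s: "s\<^sup>2 = of_int j"
    show "f (t + s) + g (t + s) = f t + g t + of_int j * (Z t + Z' t) + s * (Y t + Y' t)"
      unfolding *(5)[OF s] *(6)[OF s] by (simp add: algebra_simps)
  qed
next
  case (mult f g)
  then obtain Y Z Y' Z' where *: "int_poly_fun Y" "int_poly_fun Z" "int_poly_fun Y'" "int_poly_fun Z'"
    "\<And>s t. s\<^sup>2 = of_int j \<Longrightarrow> f (t + s) = f t + of_int j * Z t + s * Y t"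
    "\<And>s t. s\<^sup>2 = of_int j \<Longrightarrow> g (t + s) = g t + of_int j * Z' t + s * Y' t"
    by blast
  show ?case
  proof (intro exI conjI allI impI)
    show "int_poly_fun (\<lambda>t. (f t + of_int j * Z t) * Y' t + (g t + of_int j * Z' t) * Y t)"
      by (intro int_poly_fun.add int_poly_fun.mult int_poly_fun.const * mult.hyps)
    show "int_poly_fun (\<lambda>t. f t * Z' t + g t * Z t + of_int j * (Z t * Z' t) + Y t * Y' t)"
      by (intro int_poly_fun.add int_poly_fun.mult int_poly_fun.const * mult.hyps)
    fix s t :: real assume s: "s\<^sup>2 = of_int j"
    show "f (t + s) * g (t + s) = f t * g t
        + of_int j * (f t * Z' t + g t * Z t + of_int j * (Z t * Z' t) + Y t * Y' t)
        + s * ((f t + of_int j * Z t) * Y' t + (g t + of_int j * Z' t) * Y t)"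
      unfolding *(5)[OF s] *(6)[OF s] s[symmetric] by (simp add: algebra_simps power2_eq_square)
  qed
qed

text \<open>The two halves of the product, for the two signs of \<open>\<surd>j\<close>, are conjugate over the remaining
  integer polynomials, so their product is a norm.\<close>
lemma sign_prod_norm:
  assumes "int_poly_fun (sign_prod rs)"
  obtains Y Z where "int_poly_fun Y" "int_poly_fun Z"
    "\<And>t. sign_prod (sqrt (of_nat j) # rs) t
           = (sign_prod rs t + of_nat j * Z t)\<^sup>2 - of_nat j * (Y t)\<^sup>2"
proof -
  obtain Y Z where YZ: "int_poly_fun Y" "int_poly_fun Z" and
    sh: "\<And>s t. s\<^sup>2 = of_int (int j) \<Longrightarrow>
       sign_prod rs (t + s) = sign_prod rs t + of_int (int j) * Z t + s * Y t"
    using int_poly_fun_shift[OF assms, of "int j"] by blast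
  show thesis
  proof (rule that[OF YZ])
    fix t
    define s where "s = sqrt (of_nat j)"
    have s: "s\<^sup>2 = of_nat j" by (simp add: s_def)
    have "sign_prod rs (t + s) = sign_prod rs t + of_nat j * Z t + s * Y t"
         "sign_prod rs (t - s) = sign_prod rs t + of_nat j * Z t - s * Y t"
      using sh[of s t] sh[of "-s" t] s by simp_all
    then have "sign_prod (s # rs) t
        = (sign_prod rs t + of_nat j * Z t + s * Y t) * (sign_prod rs t + of_nat j * Z t - s * Y t)"
      by simp
    also have "\<dots> = (sign_prod rs t + of_nat j * Z t)\<^sup>2 - s\<^sup>2 * (Y t)\<^sup>2"
      by (simp add: power2_eq_square algebra_simps)
    finally show "sign_prod (sqrt (of_nat j) # rs) t
           = (sign_prod rs t + of_nat j * Z t)\<^sup>2 - of_nat j * (Y t)\<^sup>2"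
      unfolding s unfolding s_def .
  qed
qed

lemma int_poly_fun_diff_mult:
  "int_poly_fun f \<Longrightarrow> int_poly_fun g \<Longrightarrow> int_poly_fun (\<lambda>t. f t - of_nat j * g t)"
  using int_poly_fun.add[OF _ int_poly_fun.mult[OF int_poly_fun.const[of "- int j"]], of f g] by simp

lemma int_poly_fun_sign_prod: "int_poly_fun (sign_prod (map (\<lambda>j. sqrt (of_nat j)) js))"
proof (induction js)
  case Nil
  have "sign_prod [] = (\<lambda>t. t)" by auto
  then show ?case by (simp add: int_poly_fun.ident)
next
  case (Cons j js)
  let ?rs = "map (\<lambda>j. sqrt (of_nat j)) js"
  obtain Y Z where YZ: "int_poly_fun Y" "int_poly_fun Z" and
    eq: "\<And>t. sign_prod (sqrt (of_nat j) # ?rs) t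
           = (sign_prod ?rs t + of_nat j * Z t)\<^sup>2 - of_nat j * (Y t)\<^sup>2"
    using sign_prod_norm[OF Cons.IH] by metis
  have "int_poly_fun (\<lambda>t. sign_prod ?rs t + of_int (int j) * Z t)"
    by (intro int_poly_fun.add int_poly_fun.mult int_poly_fun.const YZ Cons.IH)
  then have "int_poly_fun (\<lambda>t. (sign_prod ?rs t + of_nat j * Z t)\<^sup>2 - of_nat j * (Y t)\<^sup>2)"
    unfolding power2_eq_square
    by (intro int_poly_fun_diff_mult int_poly_fun.mult YZ) simp_all
  then show ?case unfolding list.map eq[symmetric] .
qed

lemma sign_prod_cong_1:
  assumes "\<forall>j\<in>set js. L dvd j" "[m = 1] (mod int L)"
  shows "\<exists>k. sign_prod (map (\<lambda>j. sqrt (of_nat j)) js) (of_int m) = of_int k \<and> [k = 1] (mod int L)"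
  using assms(1)
proof (induction js)
  case Nil
  then show ?case using assms(2) by auto
next
  case (Cons j js)
  let ?rs = "map (\<lambda>j. sqrt (of_nat j)) js"
  obtain k where k: "sign_prod ?rs (of_int m) = of_int k" "[k = 1] (mod int L)"
    using Cons by auto
  obtain Y Z where YZ: "int_poly_fun Y" "int_poly_fun Z" and
    eq: "\<And>t. sign_prod (sqrt (of_nat j) # ?rs) t
           = (sign_prod ?rs t + of_nat j * Z t)\<^sup>2 - of_nat j * (Y t)\<^sup>2"
    using sign_prod_norm[OF int_poly_fun_sign_prod] by metis
  obtain y z where yz: "Y (of_int m) = of_int y" "Z (of_int m) = of_int z"
    using YZ[THEN int_poly_fun_Ints, of "of_int m"] by (auto elim!: Ints_cases)
  have "[int j = 0] (mod int L)" using Cons.prems by (simp add: cong_0_iff)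
  then have "[(k + int j * z)\<^sup>2 - int j * y\<^sup>2 = (1 + 0 * z)\<^sup>2 - 0 * y\<^sup>2] (mod int L)"
    by (intro cong_diff cong_pow cong_add cong_mult k(2) cong_refl)
  moreover have "sign_prod (sqrt (of_nat j) # ?rs) (of_int m)
      = of_int ((k + int j * z)\<^sup>2 - int j * y\<^sup>2)"
    by (simp only: eq k yz) simp
  ultimately show ?case
    unfolding list.map by (intro exI[of _ "(k + int j * z)\<^sup>2 - int j * y\<^sup>2"]) simp
qed

text \<open>The product is taken with the roots \<open>L\<surd>i = \<surd>(L\<^sup>2 i)\<close>: the factor \<open>L\<close> separates the smallest
  factor from the others by \<open>2L\<close>, enough to choose \<open>t\<close> in a residue class modulo \<open>L\<close>, and it
  makes the roots irrelevant modulo \<open>L\<close>.\<close>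
lemma simultaneous_negative_norm:
  fixes N L :: nat
  assumes "L > 0"
  obtains M :: int where "M < 0" "[M = 1] (mod int L)"
    "\<And>i. 1 \<le> i \<Longrightarrow> i \<le> N \<Longrightarrow> \<exists>x y. M = x\<^sup>2 - int i * y\<^sup>2"
proof -
  define js where "js = map (\<lambda>i. L\<^sup>2 * i) [1..<Suc N]"
  define rs where "rs = map (\<lambda>j. sqrt (of_nat j)) js"
  \<comment> \<open>This makes \<open>m = 1 + L c\<close> the largest integer below the sum of the roots that is congruent
    to 1, so it is less than \<open>2L\<close> below that sum.\<close>
  define c where "c = \<lceil>(sum_list rs - 1) / L\<rceil> - 1"
  define m where "m = 1 + int L * c"
  have ge: "\<forall>r\<in>set rs. r \<ge> real L"
    using assms by (auto simp: rs_def js_def real_sqrt_mult)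
  have "c < (sum_list rs - 1) / L" "c \<ge> (sum_list rs - 1) / L - 1"
    unfolding c_def by linarith+
  then have "L * c < sum_list rs - 1" "L * c \<ge> sum_list rs - 1 - L"
    using assms by (simp_all add: field_simps)
  then have neg: "sign_prod rs (of_int m) < 0"
    using assms by (intro sign_prod_neg[OF ge]) (auto simp: m_def)
  have "[m = 1] (mod int L)" by (simp add: m_def cong_iff_dvd_diff)
  then obtain M where M: "sign_prod rs (of_int m) = of_int M" "[M = 1] (mod int L)"
    using sign_prod_cong_1[of js L m] by (auto simp: rs_def js_def)
  show thesis
  proof (rule that[of M])
    show "M < 0" using neg M by simp
    show "[M = 1] (mod int L)" by fact
    fix i assume i: "1 \<le> i" "i \<le> N"
    define j where "j = L\<^sup>2 * i"
    have j: "j \<in> set js" using i by (auto simp: js_def j_def)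
    obtain ks where ks: "remove1 (sqrt (of_nat j)) rs = map (\<lambda>j. sqrt (of_nat j)) ks"
    proof (rule that[of "remove1 j js"])
      show "remove1 (sqrt (of_nat j)) rs = map (\<lambda>j. sqrt (of_nat j)) (remove1 j js)"
        unfolding rs_def by (induction js) auto
    qed
    have "sqrt (of_nat j) \<in> set rs" using j by (auto simp: rs_def)
    then have eq1: "sign_prod rs t = sign_prod (sqrt (of_nat j) # map (\<lambda>j. sqrt (of_nat j)) ks) t" for t
      unfolding ks[symmetric] by (rule sign_prod_remove1)
    obtain Y Z where YZ: "int_poly_fun Y" "int_poly_fun Z" and
      eq: "\<And>t. sign_prod rs t
           = (sign_prod (map (\<lambda>j. sqrt (of_nat j)) ks) t + of_nat j * Z t)\<^sup>2 - of_nat j * (Y t)\<^sup>2"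
      using sign_prod_norm[OF int_poly_fun_sign_prod] unfolding eq1 by metis
    obtain k y z where kyz: "sign_prod (map (\<lambda>j. sqrt (of_nat j)) ks) (of_int m) = of_int k"
        "Y (of_int m) = of_int y" "Z (of_int m) = of_int z"
      using YZ[THEN int_poly_fun_Ints, of "of_int m"]
        int_poly_fun_Ints[OF int_poly_fun_sign_prod, of "of_int m"]
      by (metis Ints_cases Ints_of_int)
    have "of_int M = (of_int ((k + int j * z)\<^sup>2 - int j * y\<^sup>2) :: real)"
      by (simp only: M(1)[symmetric] eq kyz) simp
    then have "M = (k + int j * z)\<^sup>2 - int j * y\<^sup>2" by (simp only: of_int_eq_iff)
    then have "M = (k + int j * z)\<^sup>2 - int i * (int L * y)\<^sup>2"
      by (simp add: j_def power_mult_distrib)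
    then show "\<exists>x y. M = x\<^sup>2 - int i * y\<^sup>2" by blast
  qed
qed

section \<open>A prime modulo which prescribed numbers are non-residues\<close>

text \<open>Descent: if \<open>p\<close> divides \<open>x\<^sup>2 - i y\<^sup>2\<close>, it must divide \<open>y\<close>, as otherwise \<open>x / y\<close> would be a square
  root of \<open>i\<close> modulo \<open>p\<close>. It then divides \<open>x\<close> too, and \<open>p\<^sup>2\<close> can be cancelled.\<close>
lemma even_multiplicity_norm:
  fixes x y i :: int
  assumes p: "prime p" and nr: "\<not> (\<exists>a. [a\<^sup>2 = i] (mod p))" and "x\<^sup>2 - i * y\<^sup>2 \<noteq> 0"
  shows "even (multiplicity p (x\<^sup>2 - i * y\<^sup>2))"
  using assms(3)
proof (induction "multiplicity p (x\<^sup>2 - i * y\<^sup>2)" arbitrary: x y rule: less_induct)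
  case less
  show ?case
  proof (cases "p dvd x\<^sup>2 - i * y\<^sup>2")
    case False
    then show ?thesis by (simp add: not_dvd_imp_multiplicity_0)
  next
    case True
    have "p dvd y"
    proof (rule ccontr)
      assume "\<not> p dvd y"
      then have "coprime y p" using p by (simp add: prime_imp_coprime coprime_commute)
      then obtain z where z: "[y * z = 1] (mod p)" using cong_solve_coprime_int by blast
      have "[x\<^sup>2 = i * y\<^sup>2] (mod p)" using True by (simp add: cong_iff_dvd_diff)
      then have "[x\<^sup>2 * z\<^sup>2 = i * y\<^sup>2 * z\<^sup>2] (mod p)" by (intro cong_mult cong_refl)
      moreover have "[i * (y * z)\<^sup>2 = i * 1\<^sup>2] (mod p)" by (intro cong_mult cong_pow z cong_refl)
      ultimately have "[(x * z)\<^sup>2 = i] (mod p)"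
        by (metis (no_types, opaque_lifting) cong_trans mult.assoc mult.right_neutral power_mult_distrib power_one)
      with nr show False by blast
    qed
    then have "p dvd x\<^sup>2" using True
      by (metis dvd_diff_left_iff dvd_mult dvd_mult2 power2_eq_square)
    then have "p dvd x" using p prime_dvd_power by blast
    then obtain x' y' where xy: "x = p * x'" "y = p * y'" using \<open>p dvd y\<close> by (auto elim!: dvdE)
    define m where "m = x'\<^sup>2 - i * y'\<^sup>2"
    have eq: "x\<^sup>2 - i * y\<^sup>2 = p * (p * m)"
      by (simp add: xy m_def algebra_simps power2_eq_square)
    with less.prems have "m \<noteq> 0" by auto
    have step: "multiplicity p (p * z) = Suc (multiplicity p z)" if "z \<noteq> 0" for z
      using that p by (intro multiplicity_times_same) (auto dest: not_prime_unit)
    have "p \<noteq> 0" using p by auto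
    with \<open>m \<noteq> 0\<close> have mult: "multiplicity p (x\<^sup>2 - i * y\<^sup>2) = Suc (Suc (multiplicity p m))"
      by (simp add: eq step)
    have "even (multiplicity p m)"
      using less.hyps[of x' y'] mult \<open>m \<noteq> 0\<close> by (simp add: m_def)
    then show ?thesis by (simp add: mult)
  qed
qed

text \<open>Otherwise every prime power in the factorization of \<open>n\<close> would be 1 modulo 4.\<close>
lemma odd_multiplicity_3_mod_4:
  fixes n :: nat
  assumes n: "n mod 4 = 3"
  shows "\<exists>p. prime p \<and> p mod 4 = 3 \<and> odd (multiplicity p n)"
proof (rule ccontr)
  assume neg: "\<not> ?thesis"
  have "n > 0" "odd n" using n by presburger+
  have "[p ^ multiplicity p n = 1] (mod 4)" if "p \<in> prime_factors n" for p
  proof -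
    have p: "prime p" "odd p"
      using that \<open>odd n\<close> dvd_trans[OF _ in_prime_factors_imp_dvd[OF that]]
      by (auto dest: in_prime_factors_imp_prime)
    have "p mod 4 = 1 \<or> p mod 4 = 3" using p(2) by presburger
    then consider "p mod 4 = 1" | "p mod 4 = 3" by blast
    then show ?thesis
    proof cases
      case 1
      then show ?thesis using cong_pow[of p 1 4 "multiplicity p n"] by (simp add: cong_def)
    next
      case 2
      then obtain k where k: "multiplicity p n = 2 * k" using neg p by (blast elim: evenE)
      have "[p * p = 3 * 3] (mod 4)" using 2 by (intro cong_mult) (simp_all add: cong_def)
      then have "[p\<^sup>2 = 1] (mod 4)" by (simp add: power2_eq_square cong_def)
      then show ?thesis using cong_pow[of "p\<^sup>2" 1 4 k] by (simp add: k power_mult)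
    qed
  qed
  then have "[(\<Prod>p\<in>prime_factors n. p ^ multiplicity p n) = (\<Prod>p\<in>prime_factors n. 1)] (mod 4)"
    by (rule cong_prod)
  then have "[n = 1] (mod 4)" using prime_factorization_nat[OF \<open>n > 0\<close>] by simp
  with n show False by (simp add: cong_def)
qed

lemma fermat_int:
  fixes a :: int
  assumes "prime p" "\<not> int p dvd a"
  shows "[a ^ (p - 1) = 1] (mod int p)"
proof -
  define b where "b = nat (a mod int p)"
  have "p > 0" using assms by (simp add: prime_gt_0_nat)
  then have b: "int b = a mod int p" by (simp add: b_def)
  have "\<not> p dvd b"
    using assms(2) by (metis b dvd_mod_iff dvd_refl int_dvd_int_iff)
  from fermat_theorem[OF assms(1) this] have "[int b ^ (p - 1) = 1] (mod int p)"
    by (metis cong_int_iff of_nat_1 of_nat_power)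
  moreover have "[int b = a] (mod int p)" by (simp add: b)
  ultimately show ?thesis using cong_pow cong_sym cong_trans by blast
qed

text \<open>This is how the fact that \<open>-1\<close> is not a square modulo \<open>p\<close> enters. Raising
  \<open>a\<^sup>2 \<equiv> -x\<^sup>2\<close> to the odd power \<open>(p - 1) / 2\<close> would give \<open>1 \<equiv> -1\<close> by Fermat's theorem.\<close>
lemma sum_squares_3_mod_4:
  fixes a x :: int
  assumes p: "prime p" "p mod 4 = 3" and d: "int p dvd a\<^sup>2 + x\<^sup>2"
  shows "int p dvd a"
proof (rule ccontr)
  assume na: "\<not> int p dvd a"
  have nx: "\<not> int p dvd x"
  proof
    assume "int p dvd x"
    then have "int p dvd a\<^sup>2" using d by (metis dvd_add_left_iff dvd_mult power2_eq_square)
    with na p(1) show False by (simp add: prime_dvd_power_iff)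
  qed
  define k where "k = (p - 1) div 2"
  have k: "p - 1 = 2 * k" "odd k" using p(2) unfolding k_def by presburger+
  have "[a\<^sup>2 = - (x\<^sup>2)] (mod int p)" using d by (simp add: cong_iff_dvd_diff)
  then have "[(a\<^sup>2) ^ k = (- (x\<^sup>2)) ^ k] (mod int p)" by (rule cong_pow)
  then have "[a ^ (p - 1) = - (x ^ (p - 1))] (mod int p)"
    using k by (simp add: power_mult)
  moreover have "[- (x ^ (p - 1)) = - 1] (mod int p)"
    using fermat_int[OF p(1) nx] by (simp add: cong_minus_minus_iff)
  moreover have "[a ^ (p - 1) = 1] (mod int p)" by (rule fermat_int[OF p(1) na])
  ultimately have "[1 = - 1] (mod int p)" by (meson cong_sym cong_trans)
  then have "int p dvd 2" by (simp add: cong_iff_dvd_diff)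
  then have "p \<le> 2" by (auto dest: zdvd_imp_le)
  with p(2) show False by (auto simp: le_Suc_eq numeral_2_eq_2)
qed

text \<open>The prime is one of odd multiplicity in the simultaneous norm \<open>M\<close>. If \<open>p\<close> divided
  \<open>1 + n + x\<^sup>2\<close>, then with \<open>a\<^sup>2 \<equiv> 1 + n\<close> it would divide the sum of two squares \<open>a\<^sup>2 + x\<^sup>2\<close>, hence
  also \<open>1 + n\<close>, contrary to its being coprime to \<open>N!\<close>.\<close>
lemma prime_negatives_nonresidues:
  obtains p where "prime p" "p \<ge> 3" "\<And>n x. n < N \<Longrightarrow> \<not> int p dvd 1 + int n + x\<^sup>2"
proof -
  define L where "L = (4 * fact N :: nat)"
  have "L > 0" by (simp add: L_def)
  then obtain M :: int where M: "M < 0" "[M = 1] (mod int L)"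
    "\<And>i. 1 \<le> i \<Longrightarrow> i \<le> N \<Longrightarrow> \<exists>x y. M = x\<^sup>2 - int i * y\<^sup>2"
    using simultaneous_negative_norm by metis
  define n where "n = nat (- M)"
  have "[M = 1] (mod 4)" using M(2) by (rule cong_dvd_modulus) (simp add: L_def)
  then have "int n mod 4 = 3" using M(1) unfolding n_def cong_def by simp presburger
  then have "n mod 4 = 3" by presburger
  then obtain p where p: "prime p" "p mod 4 = 3" "odd (multiplicity p n)"
    using odd_multiplicity_3_mod_4 by blast
  have "M = - int n" using M(1) by (simp add: n_def)
  then have dvd: "int p ^ k dvd M \<longleftrightarrow> p ^ k dvd n" for k
    by (simp flip: of_nat_power)
  have "n \<noteq> 0" "\<not> is_unit p" using \<open>n mod 4 = 3\<close> p(1) by auto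
  then have "multiplicity (int p) M = multiplicity p n"
    by (intro multiplicity_eqI)
       (simp_all only: dvd multiplicity_dvd power_dvd_iff_le_multiplicity Suc_n_not_le_n not_False_eq_True)
  then have odd: "odd (multiplicity (int p) M)" using p(3) by simp
  then have pM: "int p dvd M" using not_dvd_imp_multiplicity_0 by fastforce
  have pL: "\<not> int p dvd int L"
  proof
    assume "int p dvd int L"
    then have "[M = 1] (mod int p)" using M(2) cong_dvd_modulus by blast
    then have "int p dvd 1" using pM cong_dvd_iff by blast
    with p(1) show False by auto
  qed
  show thesis
  proof (rule that[OF p(1)])
    show "p \<ge> 3" using p(2) by presburger
    fix n :: nat and x :: int
    assume n: "n < N"
    show "\<not> int p dvd 1 + int n + x\<^sup>2"
    proof
      assume d: "int p dvd 1 + int n + x\<^sup>2"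
      obtain u v where uv: "M = u\<^sup>2 - int (Suc n) * v\<^sup>2" using M(3)[of "Suc n"] n by auto
      have "\<exists>a. [a\<^sup>2 = int (Suc n)] (mod int p)"
        using even_multiplicity_norm[of "int p" "int (Suc n)" u v] odd M(1) p(1)
        unfolding uv[symmetric] by auto
      then obtain a where a: "[a\<^sup>2 = int (Suc n)] (mod int p)" by blast
      have "[a\<^sup>2 + x\<^sup>2 = int (Suc n) + x\<^sup>2] (mod int p)" by (intro cong_add a cong_refl)
      then have "int p dvd a\<^sup>2 + x\<^sup>2" using d by (simp add: cong_dvd_iff add.commute)
      then have "int p dvd a" using sum_squares_3_mod_4 p by blast
      then have "int p dvd a\<^sup>2" by (simp add: power2_eq_square)
      then have "int p dvd int (Suc n)" using a cong_dvd_iff by blast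
      then have "p dvd Suc n" by (simp only: int_dvd_int_iff)
      then have "p dvd L" using n unfolding L_def by (intro dvd_mult dvd_trans[OF _ dvd_fact]) auto
      with pL show False by simp
    qed
  qed
qed

section \<open>The prime field as a meadow\<close>

text \<open>Elements of the field with \<open>p\<close> elements are represented by arbitrary integers, with congruence
  modulo \<open>p\<close> as equality. The power \<open>a\<^bsup>p-2\<^esup>\<close> is the inverse of \<open>a\<close> by Fermat's theorem; for
  \<open>p \<ge> 3\<close> it also sends 0 to 0, as a meadow requires.\<close>
primrec residue_eval :: "nat \<Rightarrow> (nat \<Rightarrow> int) \<Rightarrow> mterm \<Rightarrow> int" where
  "residue_eval p \<rho> (MVar x) = \<rho> x"
| "residue_eval p \<rho> MZero = 0"
| "residue_eval p \<rho> MOne = 1"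
| "residue_eval p \<rho> (MAdd s t) = residue_eval p \<rho> s + residue_eval p \<rho> t"
| "residue_eval p \<rho> (MMul s t) = residue_eval p \<rho> s * residue_eval p \<rho> t"
| "residue_eval p \<rho> (MNeg t) = - residue_eval p \<rho> t"
| "residue_eval p \<rho> (MInv t) = residue_eval p \<rho> t ^ (p - 2)"

lemma residue_eval_msubst:
  "residue_eval p \<rho> (msubst \<sigma> t) = residue_eval p (\<lambda>x. residue_eval p \<rho> (\<sigma> x)) t"
  by (induction t) auto

lemma residue_eval_mnumeral: "residue_eval p \<rho> (mnumeral n) = int n"
  by (induction n) auto

lemma residue_eval_sound:
  assumes "\<And>s t \<rho>. (s, t) \<in> E \<Longrightarrow> [residue_eval p \<rho> s = residue_eval p \<rho> t] (mod int p)"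
    and "derivable E s t"
  shows "[residue_eval p \<rho> s = residue_eval p \<rho> t] (mod int p)"
  using assms(2)
proof (induction rule: derivable.induct)
  case (ax s t)
  then show ?case by (simp add: residue_eval_msubst assms(1))
next
  case (trans s t u)
  then show ?case using cong_trans by blast
qed (auto simp: cong_minus_minus_iff intro: cong_sym cong_add cong_mult cong_pow)

lemma residue_eval_Md:
  assumes p: "prime p" "p \<ge> 3" and st: "(s, t) \<in> Md"
  shows "[residue_eval p \<rho> s = residue_eval p \<rho> t] (mod int p)"
proof -
  have inv: "[a * (a * a ^ (p - 2)) = a] (mod int p)" for a :: int
  proof (cases "int p dvd a")
    case True
    then show ?thesis by (simp add: cong_iff_dvd_diff)
  next
    case False
    have "a * (a * a ^ (p - 2)) = a * a ^ Suc (p - 2)" by simp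
    also have "Suc (p - 2) = p - 1" using p(2) by simp
    finally have "a * (a * a ^ (p - 2)) = a * a ^ (p - 1)" .
    moreover have "[a * a ^ (p - 1) = a * 1] (mod int p)"
      by (intro cong_mult cong_refl fermat_int p False)
    ultimately show ?thesis by (simp only: mult_1_right)
  qed
  have invinv: "[(a ^ (p - 2)) ^ (p - 2) = a] (mod int p)" for a :: int
  proof (cases "int p dvd a")
    case True
    then have "int p dvd (a ^ (p - 2)) ^ (p - 2)"
      using p(2) by (auto simp flip: power_mult intro: dvd_power_le[of _ _ 1, simplified] dvd_trans[OF _ dvd_power])
    then show ?thesis using True by (simp add: cong_iff_dvd_diff)
  next
    case False
    \<comment> \<open>The exponent is \<open>(p - 2)\<^sup>2 = (p - 1) (p - 3) + 1\<close>.\<close>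
    obtain q where q: "p = q + 3" using p(2) by (metis le_add_diff_inverse2)
    have "(a ^ (p - 2)) ^ (p - 2) = (a ^ (p - 1)) ^ q * a"
      unfolding q by (simp add: algebra_simps flip: power_mult power_Suc power_add)
    moreover have "[(a ^ (p - 1)) ^ q * a = 1 ^ q * a] (mod int p)"
      by (intro cong_mult cong_pow fermat_int p False cong_refl)
    ultimately show ?thesis by simp
  qed
  show ?thesis
    using st by (auto simp: Md_def Let_def algebra_simps inv invinv simp del: mult.assoc)
qed

lemma residue_eval_H:
  assumes p: "prime p" "p \<ge> 3" and nz: "\<And>x. \<not> int p dvd 1 + int n + x\<^sup>2" and st: "(s, t) = H n"
  shows "[residue_eval p \<rho> s = residue_eval p \<rho> t] (mod int p)"
proof -
  define a where "a = 1 + int n + (\<rho> 0)\<^sup>2"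
  have "a * a ^ (p - 2) = a ^ Suc (p - 2)" by simp
  also have "Suc (p - 2) = p - 1" using p(2) by simp
  finally have "[a * a ^ (p - 2) = 1] (mod int p)" using fermat_int[OF p(1) nz] by (simp add: a_def)
  then show ?thesis
    using st by (simp add: H_def Let_def residue_eval_mnumeral a_def power2_eq_square)
qed

section \<open>Numerals in the initial algebra\<close>

lemma mnumeral_closed [simp]: "mnumeral n \<in> closed_terms"
  by (induction n) auto

text \<open>An isomorphism preserves 0, 1 and addition, so it sends the number \<open>n\<close> to the class of its
  numeral; the identity \<open>n \<cdot> n\<inverse> = 1\<close> of rational numbers then becomes a derivable equation.\<close>
lemma iso_numeral_invertible:
  assumes iso: "Q0 \<cong>\<^sub>M initial_algebra E" and "n > 0"
  shows "derivable E (MMul (mnumeral n) (MInv (mnumeral n))) MOne"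
proof -
  obtain h where "malgebra_iso Q0 (initial_algebra E) h"
    using iso by (auto simp: malgebra_isomorphic_def)
  then have h: "h 0 = closed_class E MZero" "h 1 = closed_class E MOne"
    "\<And>x y. h (x + y) = madd (initial_algebra E) (h x) (h y)"
    "\<And>x y. h (x * y) = mmul (initial_algebra E) (h x) (h y)"
    "\<And>x. h (inverse x) = minv (initial_algebra E) (h x)"
    by (auto simp: malgebra_iso_def Q0_def initial_algebra_def)
  have num: "h (of_nat k) = closed_class E (mnumeral k)" for k
  proof (induction k)
    case (Suc k)
    have "h (of_nat (Suc k)) = madd (initial_algebra E) (h (of_nat k)) (h 1)"
      by (simp add: add.commute flip: h(3))
    then show ?case by (simp add: Suc h(2) initial_algebra_ops)
  qed (simp add: h)
  have "closed_class E MOne = h (of_nat n * inverse (of_nat n))"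
    using \<open>n > 0\<close> by (simp add: h(2))
  also have "\<dots> = closed_class E (MMul (mnumeral n) (MInv (mnumeral n)))"
    by (simp add: h(4,5) num initial_algebra_ops(2) initial_algebra_ops(4)[of MZero])
  finally have "(MMul (mnumeral n) (MInv (mnumeral n)), MOne) \<in> closed_eq E"
    using eq_equiv_class[OF _ equiv_closed_eq] by (metis closed_terms_simps(3))
  then show ?thesis by (simp add: closed_eq_def)
qed

theorem theorem3:
  fixes \<Gamma> :: "mequation set"
  assumes "\<Gamma> \<subseteq> {H n | n. True}" and "finite \<Gamma>"
  shows "\<not> (Q0 \<cong>\<^sub>M initial_algebra (Md \<union> \<Gamma>))"
proof
  assume iso: "Q0 \<cong>\<^sub>M initial_algebra (Md \<union> \<Gamma>)"
  have "\<Gamma> \<subseteq> range H" using assms(1) by auto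
  then obtain C where "finite C" and C: "\<Gamma> = H ` C"
    using finite_subset_image[OF assms(2)] by metis
  then obtain N where N: "\<forall>n\<in>C. n < N" using finite_nat_set_iff_bounded by blast
  obtain p where p: "prime p" "p \<ge> 3" and nz: "\<And>n x. n < N \<Longrightarrow> \<not> int p dvd 1 + int n + x\<^sup>2"
    using prime_negatives_nonresidues by blast
  have model: "[residue_eval p \<rho> s = residue_eval p \<rho> t] (mod int p)"
    if "(s, t) \<in> Md \<union> \<Gamma>" for s t \<rho>
    using that C N nz by (auto intro: residue_eval_Md[OF p] residue_eval_H[OF p])
  have "derivable (Md \<union> \<Gamma>) (MMul (mnumeral p) (MInv (mnumeral p))) MOne"
    using iso p(2) by (intro iso_numeral_invertible) auto
  from residue_eval_sound[OF model this] have "[int p * int p ^ (p - 2) = 1] (mod int p)"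
    by (simp add: residue_eval_mnumeral)
  then have "int p dvd 1" using cong_dvd_iff[of "int p * int p ^ (p - 2)" 1 "int p"] by simp
  with p(1) show False by auto
qed

end
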